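(* The bi-infinite Tamari lattice satisfies $\mathrm{Tam}_{\pm\infty}\simeq\varprojlim\mathcal{O}(\mathsf{B}'_n)$ as posets, where the inverse limit (in the category of posets) is over positive integers $n$ with transition maps $\Psi_{nm}:\mathcal{O}(\mathsf{B}'_n)\to\mathcal{O}(\mathsf{B}'_m)$ for $m\le n$.
   Context: A pointed subset $(S,i)$ of a set $\mathcal{I}$ is a pair with $S\subseteq\mathcal{I}$, $i\in S$ (pointed at $i$), often identified with $S$. For a collection $\mathsf{B}$ of pointed subsets of $\mathcal{I}$, $\mathsf{B}|_i$ denotes those pointed at $i$; an ornamentation of $\mathsf{B}$ is a function $\rho:\mathcal{I}\to\mathsf{B}$ with $\rho(i)\in\mathsf{B}|_i$ for all $i$, and $\rho(j)\subseteq\rho(i)$ whenever $j\in\rho(i)$. $\mathcal{O}(\mathsf{B})$ is the set of ornamentations ordered by $\rho_1\preceq\rho_2$ iff $\rho_1(i)\subseteq\rho_2(i)$ for all $i$. For integers $a\le b$, $[a,b]:=\{i\in\mathbb{Z}\mid a\le i\le b\}$ and $[a,\infty):=\{i\in\mathbb{Z}\mid a\le i\}$. The bi-infinite Tamari lattice is $\mathrm{Tam}_{\pm\infty}:=\mathcal{O}(\mathsf{B})$ with $\mathcal{I}=\mathbb{Z}$ and $\mathsf{B}=\{([a,b],a)\mid a,b\in\mathbb{Z},\ a\le b\}\cup\{([a,\infty),a)\mid a\in\mathbb{Z}\}$. For $n\ge1$ let $\mathcal{I}'_n=\{-k,\dots,k\}$ if $n=2k+1$ and $\mathcal{I}'_n=\{-k+1,\dots,k\}$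 if $n=2k$, and let $\mathsf{B}'_n=\{([a,b],a)\mid a\le b,\ a,b\in\mathcal{I}'_n\}$, a collection of pointed subsets of $\mathcal{I}'_n$. (Each $\mathcal{O}(\mathsf{B}'_n)$ is isomorphic to the $n$-th Tamari lattice.) For $m\le n$ the map $\Psi_{nm}:\mathcal{O}(\mathsf{B}'_n)\to\mathcal{O}(\mathsf{B}'_m)$ sends $\rho$ to the ornamentation whose value at $i\in\mathcal{I}'_m$ is the largest element of $\mathsf{B}'_m|_i$ contained in $\rho(i)$. *)

theory Defs
  imports "HOL-Library.FuncSet" "HOL-Algebra.Order"
begin

section \<open>Posets, isomorphisms and inverse limits\<close>

text \<open>Posets are \<open>gorder\<close> records satisfying \<open>partial_order\<close>, so that
  \<open>eq\<close> is equality. The predicate \<open>isotone\<close> does not say where the map takes its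
  values, hence the separate membership in the function space.\<close>

definition poset_hom :: "('a, 'c) gorder_scheme \<Rightarrow> ('b, 'd) gorder_scheme \<Rightarrow> ('a \<Rightarrow> 'b) \<Rightarrow> bool" where
  "poset_hom P Q f \<longleftrightarrow> f \<in> carrier P \<rightarrow> carrier Q \<and> isotone P Q f"

definition poset_iso :: "('a, 'c) gorder_scheme \<Rightarrow> ('b, 'd) gorder_scheme \<Rightarrow> ('a \<Rightarrow> 'b) \<Rightarrow> bool" where
  "poset_iso P Q f \<longleftrightarrow>
     bij_betw f (carrier P) (carrier Q) \<and>
     poset_hom P Q f \<and> poset_hom Q P (inv_into (carrier P) f)"

definition poset_isomorphic :: "('a, 'c) gorder_scheme \<Rightarrow> ('b, 'd) gorder_scheme \<Rightarrow> bool"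
    (infix \<open>\<simeq>\<^sub>p\<close> 50) where
  "P \<simeq>\<^sub>p Q \<longleftrightarrow> partial_order P \<and> partial_order Q \<and> (\<exists>f. poset_iso P Q f)"

text \<open>For \<open>i \<le> j\<close> in the index set \<open>D\<close>, the transition map \<open>t j i\<close> goes
  from \<open>X j\<close> to \<open>X i\<close>.\<close>

locale poset_inverse_system =
  fixes D :: "'i::order set" and X :: "'i \<Rightarrow> 'a gorder" and t :: "'i \<Rightarrow> 'i \<Rightarrow> 'a \<Rightarrow> 'a"
  assumes directed: "D \<noteq> {}" "\<And>i j. i \<in> D \<Longrightarrow> j \<in> D \<Longrightarrow> \<exists>k\<in>D. i \<le> k \<and> j \<le> k"
    and poset: "\<And>i. i \<in> D \<Longrightarrow> partial_order (X i)"
    and hom: "\<And>i j. i \<in> D \<Longrightarrow> j \<in> D \<Longrightarrow> i \<le> j \<Longrightarrow> poset_hom (X j) (X i) (t j i)"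
    and ident: "\<And>i x. i \<in> D \<Longrightarrow> x \<in> carrier (X i) \<Longrightarrow> t i i x = x"
    and compose: "\<And>i j k x. i \<in> D \<Longrightarrow> j \<in> D \<Longrightarrow> k \<in> D \<Longrightarrow> i \<le> j \<Longrightarrow> j \<le> k \<Longrightarrow>
      x \<in> carrier (X k) \<Longrightarrow> t j i (t k j x) = t k i x"

definition inverse_limit :: "'i::order set \<Rightarrow> ('i \<Rightarrow> 'a gorder) \<Rightarrow> ('i \<Rightarrow> 'i \<Rightarrow> 'a \<Rightarrow> 'a) \<Rightarrow> ('i \<Rightarrow> 'a) gorder"
  where "inverse_limit D X t =
    \<lparr> carrier = {x \<in> (\<Pi>\<^sub>E i\<in>D. carrier (X i)). \<forall>i\<in>D. \<forall>j\<in>D. i \<le> j \<longrightarrow> t j i (x j) = x i},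
      eq = (=),
      le = (\<lambda>x y. \<forall>i\<in>D. x i \<sqsubseteq>\<^bsub>X i\<^esub> y i) \<rparr>"

context poset_inverse_system
begin

lemma partial_order_inverse_limit: "partial_order (inverse_limit D X t)"
proof unfold_locales
  fix x y assume *: "x \<sqsubseteq>\<^bsub>inverse_limit D X t\<^esub> y" "y \<sqsubseteq>\<^bsub>inverse_limit D X t\<^esub> x"
    "x \<in> carrier (inverse_limit D X t)" "y \<in> carrier (inverse_limit D X t)"
  have "x i = y i" if "i \<in> D" for i
  proof -
    interpret partial_order "X i" by (rule poset[OF that])
    show ?thesis using * that by (intro le_antisym) (auto simp: inverse_limit_def)
  qed
  with * show "x .=\<^bsub>inverse_limit D X t\<^esub> y"
    by (auto simp: inverse_limit_def intro: PiE_ext)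
next
  fix x assume x: "x \<in> carrier (inverse_limit D X t)"
  have "x i \<sqsubseteq>\<^bsub>X i\<^esub> x i" if "i \<in> D" for i
  proof -
    interpret partial_order "X i" by (rule poset[OF that])
    have "x i \<in> carrier (X i)" using x that by (auto simp: inverse_limit_def)
    then show ?thesis by (rule le_refl)
  qed
  then show "x \<sqsubseteq>\<^bsub>inverse_limit D X t\<^esub> x" by (simp add: inverse_limit_def)
next
  fix x y z assume *: "x \<sqsubseteq>\<^bsub>inverse_limit D X t\<^esub> y" "y \<sqsubseteq>\<^bsub>inverse_limit D X t\<^esub> z"
    "x \<in> carrier (inverse_limit D X t)" "y \<in> carrier (inverse_limit D X t)"
    "z \<in> carrier (inverse_limit D X t)"
  have "x i \<sqsubseteq>\<^bsub>X i\<^esub> z i" if "i \<in> D" for i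
  proof -
    interpret partial_order "X i" by (rule poset[OF that])
    show ?thesis using * that by - (rule le_trans[of "x i" "y i"], auto simp: inverse_limit_def)
  qed
  then show "x \<sqsubseteq>\<^bsub>inverse_limit D X t\<^esub> z" by (simp add: inverse_limit_def)
qed (auto simp: inverse_limit_def)

lemma inverse_limit_projection:
  assumes "i \<in> D"
  shows "poset_hom (inverse_limit D X t) (X i) (\<lambda>x. x i)"
  using partial_order_inverse_limit poset[OF assms] assms
  by (auto simp: poset_hom_def isotone_def inverse_limit_def partial_order_def)

text \<open>The concrete construction is the limit in the category of posets. Since the type of
  \<open>Q\<close> is arbitrary, this is the universal property with respect to all posets.\<close>

lemma inverse_limit_universal:
  fixes Q :: "('b, 'c) gorder_scheme"
  assumes Q: "partial_order Q"
    and g: "\<And>i. i \<in> D \<Longrightarrow> poset_hom Q (X i) (g i)"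
    and comp: "\<And>i j x. i \<in> D \<Longrightarrow> j \<in> D \<Longrightarrow> i \<le> j \<Longrightarrow> x \<in> carrier Q \<Longrightarrow> t j i (g j x) = g i x"
  shows "\<exists>!u. u \<in> extensional (carrier Q) \<and> poset_hom Q (inverse_limit D X t) u \<and>
    (\<forall>i\<in>D. \<forall>x\<in>carrier Q. u x i = g i x)"
proof (rule ex_ex1I)
  let ?u = "\<lambda>x\<in>carrier Q. \<lambda>i\<in>D. g i x"
  have "poset_hom Q (inverse_limit D X t) ?u"
    using Q partial_order_inverse_limit g comp
    by (auto simp: poset_hom_def isotone_def inverse_limit_def partial_order_def Pi_iff)
  then show "\<exists>u. u \<in> extensional (carrier Q) \<and> poset_hom Q (inverse_limit D X t) u \<and>
      (\<forall>i\<in>D. \<forall>x\<in>carrier Q. u x i = g i x)"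
    by (intro exI[of _ ?u]) auto
next
  fix u v
  assume u: "u \<in> extensional (carrier Q) \<and> poset_hom Q (inverse_limit D X t) u \<and>
      (\<forall>i\<in>D. \<forall>x\<in>carrier Q. u x i = g i x)"
    and v: "v \<in> extensional (carrier Q) \<and> poset_hom Q (inverse_limit D X t) v \<and>
      (\<forall>i\<in>D. \<forall>x\<in>carrier Q. v x i = g i x)"
  show "u = v"
  proof (rule extensionalityI[of _ "carrier Q"])
    fix x assume x: "x \<in> carrier Q"
    have "u x \<in> (\<Pi>\<^sub>E i\<in>D. carrier (X i))" "v x \<in> (\<Pi>\<^sub>E i\<in>D. carrier (X i))"
      using u v x by (auto simp: poset_hom_def inverse_limit_def Pi_iff)
    then show "u x = v x" by (rule PiE_ext) (use u v x in auto)
  qed (use u v in auto)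
qed

end


section \<open>Ornamentations\<close>

type_synonym 'a pointed = "'a set \<times> 'a"

definition pointed_subsets :: "'a set \<Rightarrow> 'a pointed set" where
  "pointed_subsets I = {(S, i). S \<subseteq> I \<and> i \<in> S}"

definition pointed_at :: "'a pointed set \<Rightarrow> 'a \<Rightarrow> 'a pointed set" where
  "pointed_at B i = {p \<in> B. snd p = i}"

text \<open>Functions on \<open>I\<close> are extensional (\<open>undefined\<close> outside \<open>I\<close>),
  so that equality of ornamentations is equality on \<open>I\<close>.\<close>

definition ornamentations :: "'a set \<Rightarrow> 'a pointed set \<Rightarrow> ('a \<Rightarrow> 'a pointed) set" where
  "ornamentations I B =
     {\<rho> \<in> (\<Pi>\<^sub>E i\<in>I. pointed_at B i).
        \<forall>i\<in>I. \<forall>j\<in>fst (\<rho> i). fst (\<rho> j) \<subseteq> fst (\<rho> i)}"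

definition ornamentation_poset :: "'a set \<Rightarrow> 'a pointed set \<Rightarrow> ('a \<Rightarrow> 'a pointed) gorder" where
  "ornamentation_poset I B =
     \<lparr> carrier = ornamentations I B,
       eq = (=),
       le = (\<lambda>\<rho>\<^sub>1 \<rho>\<^sub>2. \<forall>i\<in>I. fst (\<rho>\<^sub>1 i) \<subseteq> fst (\<rho>\<^sub>2 i)) \<rparr>"

lemma partial_order_ornamentation_poset: "partial_order (ornamentation_poset I B)"
proof unfold_locales
  fix x y assume *: "x \<sqsubseteq>\<^bsub>ornamentation_poset I B\<^esub> y" "y \<sqsubseteq>\<^bsub>ornamentation_poset I B\<^esub> x"
    "x \<in> carrier (ornamentation_poset I B)" "y \<in> carrier (ornamentation_poset I B)"
  then have xy: "x \<in> (\<Pi>\<^sub>E i\<in>I. pointed_at B i)" "y \<in> (\<Pi>\<^sub>E i\<in>I. pointed_at B i)"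
    by (auto simp: ornamentation_poset_def ornamentations_def)
  have "x = y"
  proof (rule PiE_ext[OF xy])
    fix i assume i: "i \<in> I"
    have "snd (x i) = i" "snd (y i) = i"
      using xy i by (auto simp: PiE_iff pointed_at_def)
    moreover have "fst (x i) = fst (y i)"
      using * i by (auto simp: ornamentation_poset_def)
    ultimately show "x i = y i" by (simp add: prod_eq_iff)
  qed
  then show "x .=\<^bsub>ornamentation_poset I B\<^esub> y" by (simp add: ornamentation_poset_def)
qed (auto simp: ornamentation_poset_def)


section \<open>The bi-infinite Tamari lattice and the finite Tamari lattices\<close>

definition tam_bi_infinite_pointed :: "int pointed set" where
  "tam_bi_infinite_pointed = {({a..b}, a) | a b. a \<le> b} \<union> {({a..}, a) | a. True}"

definition Tam_bi_infinite :: "(int \<Rightarrow> int pointed) gorder" where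
  "Tam_bi_infinite = ornamentation_poset UNIV tam_bi_infinite_pointed"

text \<open>Here \<open>n div 2\<close> is \<open>k\<close> both for \<open>n = 2 * k\<close> and for \<open>n = 2 * k + 1\<close>.\<close>

definition tam_index :: "nat \<Rightarrow> int set" where
  "tam_index n =
     (let k = int (n div 2) in if odd n then {- k..k} else {- k + 1..k})"

definition tam_pointed :: "nat \<Rightarrow> int pointed set" where
  "tam_pointed n = {({a..b}, a) | a b. a \<le> b \<and> a \<in> tam_index n \<and> b \<in> tam_index n}"

definition tam_poset :: "nat \<Rightarrow> (int \<Rightarrow> int pointed) gorder" where
  "tam_poset n = ornamentation_poset (tam_index n) (tam_pointed n)"

definition tam_transition :: "nat \<Rightarrow> nat \<Rightarrow> (int \<Rightarrow> int pointed) \<Rightarrow> (int \<Rightarrow> int pointed)" where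
  "tam_transition n m \<rho> =
     (\<lambda>i\<in>tam_index m.
        (GREATEST S. (S, i) \<in> pointed_at (tam_pointed m) i \<and> S \<subseteq> fst (\<rho> i), i))"

text \<open>The collections consist of pointed subsets, the largest element in
  \<open>tam_transition\<close> exists, and the finite posets form an inverse system.\<close>

lemma tam_bi_infinite_pointed_subset: "tam_bi_infinite_pointed \<subseteq> pointed_subsets UNIV"
  by (auto simp: tam_bi_infinite_pointed_def pointed_subsets_def)

lemma tam_index_eq: "tam_index n = {- int ((n - 1) div 2)..int (n div 2)}" if "n \<ge> 1"
  using that by (cases "odd n") (auto simp: tam_index_def Let_def elim!: oddE evenE)

lemma tam_pointed_subset: "tam_pointed n \<subseteq> pointed_subsets (tam_index n)"
  by (auto simp: tam_pointed_def pointed_subsets_def tam_index_def Let_def split: if_splits)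

lemma tam_index_mono:
  assumes "1 \<le> m" "m \<le> n"
  shows "tam_index m \<subseteq> tam_index n"
proof -
  have "(m - 1) div 2 \<le> (n - 1) div 2" "m div 2 \<le> n div 2"
    using assms by (auto intro!: div_le_mono)
  then show ?thesis using assms by (auto simp: tam_index_eq)
qed

lemma tam_ornamentation_interval:
  assumes "\<rho> \<in> carrier (tam_poset n)" "i \<in> tam_index n"
  obtains b where "i \<le> b" "b \<in> tam_index n" "\<rho> i = ({i..b}, i)"
proof -
  have "\<rho> i \<in> pointed_at (tam_pointed n) i"
    using assms by (auto simp: tam_poset_def ornamentation_poset_def ornamentations_def)
  then show ?thesis using that by (auto simp: pointed_at_def tam_pointed_def)
qed

lemma tam_transition_interval:
  assumes "1 \<le> m" "i \<in> tam_index m" "i \<le> b" "fst (\<rho> i) = {i..b}"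
  shows "tam_transition n m \<rho> i = ({i..min b (int (m div 2))}, i)"
proof -
  let ?c = "min b (int (m div 2))"
  have "(GREATEST S. (S, i) \<in> pointed_at (tam_pointed m) i \<and> S \<subseteq> fst (\<rho> i)) = {i..?c}"
    using assms
    by (intro Greatest_equality) (auto simp: pointed_at_def tam_pointed_def tam_index_eq)
  then show ?thesis using assms by (simp add: tam_transition_def)
qed

lemma tam_transition_largest:
  assumes "1 \<le> m" "m \<le> n" "\<rho> \<in> carrier (tam_poset n)" "i \<in> tam_index m"
  shows "tam_transition n m \<rho> i \<in> pointed_at (tam_pointed m) i"
    and "fst (tam_transition n m \<rho> i) \<subseteq> fst (\<rho> i)"
    and "\<And>p. p \<in> pointed_at (tam_pointed m) i \<Longrightarrow> fst p \<subseteq> fst (\<rho> i) \<Longrightarrow>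
           fst p \<subseteq> fst (tam_transition n m \<rho> i)"
proof -
  have "i \<in> tam_index n" using tam_index_mono assms by blast
  then obtain b where b: "i \<le> b" "b \<in> tam_index n" "\<rho> i = ({i..b}, i)"
    using tam_ornamentation_interval assms by blast
  then have *: "tam_transition n m \<rho> i = ({i..min b (int (m div 2))}, i)"
    using assms by (intro tam_transition_interval) auto
  show "tam_transition n m \<rho> i \<in> pointed_at (tam_pointed m) i"
    "fst (tam_transition n m \<rho> i) \<subseteq> fst (\<rho> i)"
    "\<And>p. p \<in> pointed_at (tam_pointed m) i \<Longrightarrow> fst p \<subseteq> fst (\<rho> i) \<Longrightarrow>
       fst p \<subseteq> fst (tam_transition n m \<rho> i)"
    using assms b unfolding *
    by (auto simp: pointed_at_def tam_pointed_def tam_index_eq)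
qed

lemma tam_transition_carrier:
  assumes "1 \<le> m" "m \<le> n" "\<rho> \<in> carrier (tam_poset n)"
  shows "tam_transition n m \<rho> \<in> carrier (tam_poset m)"
proof -
  have "fst (tam_transition n m \<rho> j) \<subseteq> fst (tam_transition n m \<rho> i)"
    if i: "i \<in> tam_index m" and j: "j \<in> fst (tam_transition n m \<rho> i)" for i j
  proof -
    have sub: "tam_index m \<subseteq> tam_index n" using tam_index_mono assms by blast
    obtain b where b: "i \<le> b" "\<rho> i = ({i..b}, i)"
      using tam_ornamentation_interval assms(3) sub i by blast
    have ti: "tam_transition n m \<rho> i = ({i..min b (int (m div 2))}, i)"
      using assms b i by (intro tam_transition_interval) auto
    then have jm: "j \<in> tam_index m" and jb: "j \<in> fst (\<rho> i)"
      using i j b assms by (auto simp: tam_index_eq)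
    obtain c where c: "j \<le> c" "\<rho> j = ({j..c}, j)"
      using tam_ornamentation_interval assms(3) sub jm by blast
    have tj: "tam_transition n m \<rho> j = ({j..min c (int (m div 2))}, j)"
      using assms c jm by (intro tam_transition_interval) auto
    have "fst (\<rho> j) \<subseteq> fst (\<rho> i)"
    proof -
      have "\<forall>i\<in>tam_index n. \<forall>j\<in>fst (\<rho> i). fst (\<rho> j) \<subseteq> fst (\<rho> i)"
        using assms(3) unfolding tam_poset_def ornamentation_poset_def ornamentations_def
        by simp
      then show ?thesis using jb subsetD[OF sub i] by blast
    qed
    then show ?thesis using b c by (auto simp: ti tj)
  qed
  then show ?thesis
    using tam_transition_largest(1)[OF assms]
    by (auto simp: tam_poset_def ornamentation_poset_def ornamentations_def PiE_iff
        tam_transition_def)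
qed

lemma tam_carrier_eqI:
  assumes "x \<in> carrier (tam_poset n)" "y \<in> carrier (tam_poset n)"
    and "\<And>i. i \<in> tam_index n \<Longrightarrow> x i = y i"
  shows "x = y"
proof (rule PiE_ext)
  show "x \<in> (\<Pi>\<^sub>E i\<in>tam_index n. pointed_at (tam_pointed n) i)"
       "y \<in> (\<Pi>\<^sub>E i\<in>tam_index n. pointed_at (tam_pointed n) i)"
    using assms by (auto simp: tam_poset_def ornamentation_poset_def ornamentations_def)
qed (use assms in auto)

lemma tam_inverse_system: "poset_inverse_system {1..} tam_poset tam_transition"
proof (rule poset_inverse_system.intro)
  show "{1::nat..} \<noteq> {}" by auto
next
  fix i j :: nat assume "i \<in> {1..}" "j \<in> {1..}"
  then show "\<exists>k\<in>{1..}. i \<le> k \<and> j \<le> k" by (intro bexI[of _ "max i j"]) auto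
next
  fix i :: nat show "partial_order (tam_poset i)"
    by (simp add: tam_poset_def partial_order_ornamentation_poset)
next
  fix m n :: nat assume "m \<in> {1..}" "n \<in> {1..}" and mn: "m \<le> n"
  then have m: "1 \<le> m" by simp
  have po: "weak_partial_order (tam_poset k)" for k
    using partial_order_ornamentation_poset[of "tam_index k" "tam_pointed k"]
    by (simp add: tam_poset_def partial_order_def)
  have "tam_transition n m x \<sqsubseteq>\<^bsub>tam_poset m\<^esub> tam_transition n m y"
    if xy: "x \<in> carrier (tam_poset n)" "y \<in> carrier (tam_poset n)" "x \<sqsubseteq>\<^bsub>tam_poset n\<^esub> y" for x y
  proof -
    have "fst (tam_transition n m x i) \<subseteq> fst (tam_transition n m y i)"
      if i: "i \<in> tam_index m" for i
    proof (rule tam_transition_largest(3)[OF m mn xy(2) i])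
      show "tam_transition n m x i \<in> pointed_at (tam_pointed m) i"
        by (rule tam_transition_largest(1)[OF m mn xy(1) i])
      have "fst (x i) \<subseteq> fst (y i)"
        using xy(3) i tam_index_mono[OF m mn] by (auto simp: tam_poset_def ornamentation_poset_def)
      then show "fst (tam_transition n m x i) \<subseteq> fst (y i)"
        using tam_transition_largest(2)[OF m mn xy(1) i] by blast
    qed
    then show ?thesis by (simp add: tam_poset_def ornamentation_poset_def)
  qed
  then show "poset_hom (tam_poset n) (tam_poset m) (tam_transition n m)"
    using po tam_transition_carrier[OF m mn] by (auto simp: poset_hom_def isotone_def)
next
  fix n :: nat and x assume "n \<in> {1..}" and x: "x \<in> carrier (tam_poset n)"
  then have n: "1 \<le> n" by simp
  show "tam_transition n n x = x"
  proof (rule tam_carrier_eqI[OF tam_transition_carrier[OF n order_refl x] x])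
    fix i assume i: "i \<in> tam_index n"
    obtain b where "i \<le> b" "b \<in> tam_index n" "x i = ({i..b}, i)"
      using tam_ornamentation_interval x i by blast
    then show "tam_transition n n x i = x i"
      using n i tam_transition_interval[of n i b x n] by (auto simp: tam_index_eq)
  qed
next
  fix l m n :: nat and x
  assume "l \<in> {1..}" "m \<in> {1..}" "n \<in> {1..}" and lm: "l \<le> m" and mn: "m \<le> n"
    and x: "x \<in> carrier (tam_poset n)"
  then have l: "1 \<le> l" and m: "1 \<le> m" by auto
  note y = tam_transition_carrier[OF m mn x]
  show "tam_transition m l (tam_transition n m x) = tam_transition n l x"
  proof (rule tam_carrier_eqI[OF tam_transition_carrier[OF l lm y]
        tam_transition_carrier[OF l order_trans[OF lm mn] x]])
    fix i assume i: "i \<in> tam_index l"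
    have im: "i \<in> tam_index m" and "i \<in> tam_index n"
      using i tam_index_mono[OF l lm] tam_index_mono[OF m mn] by auto
    then obtain b where b: "i \<le> b" "x i = ({i..b}, i)"
      using tam_ornamentation_interval x by blast
    have 1: "tam_transition n m x i = ({i..min b (int (m div 2))}, i)"
      using m im b by (intro tam_transition_interval) auto
    have 2: "tam_transition n l x i = ({i..min b (int (l div 2))}, i)"
      using l i b by (intro tam_transition_interval) auto
    have "tam_transition m l (tam_transition n m x) i =
        ({i..min (min b (int (m div 2))) (int (l div 2))}, i)"
      using l i im b m 1 by (intro tam_transition_interval) (auto simp: tam_index_eq)
    moreover have "l div 2 \<le> m div 2" using lm by (rule div_le_mono)
    ultimately show "tam_transition m l (tam_transition n m x) i = tam_transition n l x i"
      by (simp add: 2 min.assoc min_absorb2)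
  qed
qed

end

theory Submission
  imports Defs
begin

text \<open>
  An ornamentation of the bi-infinite collection assigns to each \<open>i\<close> an order-convex set of
  integers with least element \<open>i\<close>. This description, unlike the list of intervals, treats
  bounded and unbounded sets alike and is stable under cutting down to a convex window and under
  unions. The windows \<open>tam_index n\<close> are convex, increasing and exhaust the integers, and the
  ornamentations in \<open>tam_poset n\<close> have the same description inside the window. Since all values
  at \<open>i\<close> start at \<open>i\<close>, the largest admissible set inside \<open>\<rho> i\<close> is the
  intersection with the window (\<open>tam_transition_eq_window\<close>). Hence a compatible family is a
  coherent system of intersections of one set per integer with growing windows. Such a system
  arises from exactly one family of sets, recovered as the union: intersecting with all windows
  (\<open>windows\<close>) and gluing by unions (\<open>glue\<close>) are mutually inverse, and both
  preserve containment because intersections and unions do.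
\<close>

section \<open>Intervals with a prescribed least element\<close>

definition convex_from :: "int \<Rightarrow> int set \<Rightarrow> bool" where
  "convex_from i S \<longleftrightarrow> i \<in> S \<and> (\<forall>x\<in>S. i \<le> x \<and> {i..x} \<subseteq> S)"

lemma convex_from_finite:
  assumes "convex_from i S" "finite S"
  shows "S = {i..Max S}"
proof -
  have "Max S \<in> S" using assms by (auto simp: convex_from_def intro: Max_in)
  with assms show ?thesis by (auto simp: convex_from_def)
qed

lemma convex_from_infinite:
  assumes "convex_from i S" "infinite S"
  shows "S = {i..}"
proof (intro equalityI subsetI)
  fix y assume "y \<in> {i..}"
  have "\<not> S \<subseteq> {i..y}" using assms(2) finite_subset by blast
  then obtain x where "x \<in> S" "y < x" using assms(1) by (force simp: convex_from_def)
  then show "y \<in> S" using assms(1) \<open>y \<in> {i..}\<close> by (force simp: convex_from_def)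
qed (use assms in \<open>auto simp: convex_from_def\<close>)

text \<open>The two kinds of members of the collection, bounded and unbounded intervals, are the finite
  and the infinite sets with this property.\<close>

lemma mem_tam_bi_infinite_pointed_iff:
  "(S, i) \<in> tam_bi_infinite_pointed \<longleftrightarrow> convex_from i S"
proof
  assume S: "convex_from i S"
  show "(S, i) \<in> tam_bi_infinite_pointed"
  proof (cases "finite S")
    case True
    then have eq: "S = {i..Max S}" by (rule convex_from_finite[OF S])
    with S have "i \<le> Max S" by (auto simp: convex_from_def)
    with eq show ?thesis unfolding tam_bi_infinite_pointed_def by blast
  next
    case False
    then show ?thesis using convex_from_infinite[OF S]
      by (auto simp: tam_bi_infinite_pointed_def)
  qed
qed (auto simp: tam_bi_infinite_pointed_def convex_from_def)

lemma mem_tam_pointed_iff: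
  assumes "1 \<le> n"
  shows "(S, i) \<in> tam_pointed n \<longleftrightarrow> convex_from i S \<and> S \<subseteq> tam_index n"
proof
  assume S: "convex_from i S \<and> S \<subseteq> tam_index n"
  then have "finite S" using assms by (auto simp: tam_index_eq intro: finite_subset)
  then have eq: "S = {i..Max S}" using S by (intro convex_from_finite) auto
  moreover have "i \<in> S" using S by (simp add: convex_from_def)
  moreover have "Max S \<in> S" using \<open>finite S\<close> \<open>i \<in> S\<close> by (intro Max_in) auto
  ultimately show "(S, i) \<in> tam_pointed n"
    using S by (auto simp: tam_pointed_def intro!: exI[of _ "Max S"])
qed (use assms in \<open>auto simp: tam_pointed_def convex_from_def tam_index_eq\<close>)

lemma convex_from_Int_window:
  assumes "convex_from i S" "1 \<le> n" "i \<in> tam_index n"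
  shows "convex_from i (S \<inter> tam_index n)"
  using assms by (fastforce simp: convex_from_def tam_index_eq)

lemma convex_from_Union:
  assumes "\<A> \<noteq> {}" "\<And>S. S \<in> \<A> \<Longrightarrow> convex_from i S"
  shows "convex_from i (\<Union>\<A>)"
  using assms unfolding convex_from_def by blast

lemma tam_index_exhausts: "\<exists>n\<ge>1. i \<in> tam_index n"
  \<comment> \<open>The windows with odd index are symmetric about \<open>0\<close>.\<close>
  by (intro exI[of _ "2 * nat \<bar>i\<bar> + 1"]) (auto simp: tam_index_eq)

lemma mem_carrier_Tam_bi_infinite_iff:
  "\<rho> \<in> carrier Tam_bi_infinite \<longleftrightarrow>
     (\<forall>i. snd (\<rho> i) = i \<and> convex_from i (fst (\<rho> i)) \<and>
       (\<forall>j\<in>fst (\<rho> i). fst (\<rho> j) \<subseteq> fst (\<rho> i)))"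
proof -
  have "p \<in> pointed_at tam_bi_infinite_pointed i \<longleftrightarrow> snd p = i \<and> convex_from i (fst p)" for p i
    using mem_tam_bi_infinite_pointed_iff[of "fst p" i] by (auto simp: pointed_at_def)
  then show ?thesis
    by (simp add: Tam_bi_infinite_def ornamentation_poset_def ornamentations_def PiE_iff) blast
qed

lemma mem_carrier_tam_poset_iff:
  assumes "1 \<le> n"
  shows "\<rho> \<in> carrier (tam_poset n) \<longleftrightarrow>
     \<rho> \<in> extensional (tam_index n) \<and>
     (\<forall>i\<in>tam_index n. snd (\<rho> i) = i \<and> convex_from i (fst (\<rho> i)) \<and> fst (\<rho> i) \<subseteq> tam_index n \<and>
       (\<forall>j\<in>fst (\<rho> i). fst (\<rho> j) \<subseteq> fst (\<rho> i)))"
proof -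
  have "p \<in> pointed_at (tam_pointed n) i \<longleftrightarrow>
      snd p = i \<and> convex_from i (fst p) \<and> fst p \<subseteq> tam_index n" for p i
    using mem_tam_pointed_iff[OF assms, of "fst p" i] by (auto simp: pointed_at_def)
  then show ?thesis
    by (simp add: tam_poset_def ornamentation_poset_def ornamentations_def PiE_iff) blast
qed


section \<open>Cutting to a window and gluing\<close>

definition window :: "nat \<Rightarrow> (int \<Rightarrow> int pointed) \<Rightarrow> int \<Rightarrow> int pointed" where
  "window n \<rho> = (\<lambda>i\<in>tam_index n. (fst (\<rho> i) \<inter> tam_index n, i))"

definition windows :: "(int \<Rightarrow> int pointed) \<Rightarrow> nat \<Rightarrow> int \<Rightarrow> int pointed" where
  "windows \<rho> = (\<lambda>n\<in>{1..}. window n \<rho>)"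

definition glue :: "(nat \<Rightarrow> int \<Rightarrow> int pointed) \<Rightarrow> int \<Rightarrow> int pointed" where
  "glue x i = (\<Union>n\<in>{n. 1 \<le> n \<and> i \<in> tam_index n}. fst (x n i), i)"

lemma tam_transition_eq_window:
  assumes "1 \<le> m" "m \<le> n" "\<rho> \<in> carrier (tam_poset n)"
  shows "tam_transition n m \<rho> = window m \<rho>"
proof
  fix i
  show "tam_transition n m \<rho> i = window m \<rho> i"
  proof (cases "i \<in> tam_index m")
    case True
    then have "i \<in> tam_index n" using tam_index_mono assms by blast
    then obtain b where b: "i \<le> b" "\<rho> i = ({i..b}, i)"
      using tam_ornamentation_interval assms by blast
    have "tam_transition n m \<rho> i = ({i..min b (int (m div 2))}, i)"
      using assms True b by (intro tam_transition_interval) auto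
    \<comment> \<open>Everything in \<open>{i..b}\<close> is above the left end of the window because \<open>i\<close> is, so
      only the right end cuts.\<close>
    also have "{i..min b (int (m div 2))} = {i..b} \<inter> tam_index m"
      using True assms by (auto simp: tam_index_eq)
    finally show ?thesis using True b by (simp add: window_def)
  qed (simp add: tam_transition_def window_def)
qed

lemma window_in_carrier:
  assumes "\<rho> \<in> carrier Tam_bi_infinite" "1 \<le> n"
  shows "window n \<rho> \<in> carrier (tam_poset n)"
  using assms convex_from_Int_window
  by (fastforce simp: mem_carrier_tam_poset_iff mem_carrier_Tam_bi_infinite_iff window_def)

lemma windows_in_carrier:
  assumes "\<rho> \<in> carrier Tam_bi_infinite"
  shows "windows \<rho> \<in> carrier (inverse_limit {1..} tam_poset tam_transition)"
proof -
  have "tam_transition n m (window n \<rho>) = window m \<rho>" if "1 \<le> m" "m \<le> n" for m n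
  proof -
    have "tam_transition n m (window n \<rho>) = window m (window n \<rho>)"
      using that assms by (intro tam_transition_eq_window window_in_carrier) auto
    also have "\<dots> = window m \<rho>"
      using tam_index_mono[OF that] by (auto simp: window_def fun_eq_iff)
    finally show ?thesis .
  qed
  then show ?thesis
    using window_in_carrier[OF assms] by (auto simp: inverse_limit_def windows_def)
qed

text \<open>In a compatible family the set at \<open>i\<close> only grows with the stage, and all that later stages
  add lies outside the earlier window. Growth makes the glued family nested; the second half lets
  it be cut back to the original stages.\<close>

lemma inverse_limit_window:
  assumes "x \<in> carrier (inverse_limit {1..} tam_poset tam_transition)"
    and "1 \<le> m" "m \<le> n" "i \<in> tam_index m"
  shows "fst (x m i) = fst (x n i) \<inter> tam_index m"
proof -
  have "x m = tam_transition n m (x n)" "x n \<in> carrier (tam_poset n)"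
    using assms by (auto simp: inverse_limit_def)
  then show ?thesis using assms tam_transition_eq_window[of m n "x n"] by (simp add: window_def)
qed

text \<open>Nesting is the point to check: the witnesses for \<open>j\<close> lying in the glued set at
  \<open>i\<close> and for \<open>k\<close> lying in the one at \<open>j\<close> may come from different stages, but
  both persist at every later stage.\<close>

lemma glue_in_carrier:
  assumes x: "x \<in> carrier (inverse_limit {1..} tam_poset tam_transition)"
  shows "glue x \<in> carrier Tam_bi_infinite"
proof -
  have xc: "x n \<in> carrier (tam_poset n)" if "1 \<le> n" for n
    using x that by (auto simp: inverse_limit_def)
  have "convex_from i (fst (glue x i))" for i
    unfolding glue_def fst_conv
    using tam_index_exhausts[of i] xc
    by (intro convex_from_Union) (auto simp: mem_carrier_tam_poset_iff)
  moreover have "k \<in> fst (glue x i)" if j: "j \<in> fst (glue x i)" and k: "k \<in> fst (glue x j)" for i j k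
  proof -
    obtain m where m: "1 \<le> m" "i \<in> tam_index m" "j \<in> fst (x m i)"
      using j by (auto simp: glue_def)
    obtain n where n: "1 \<le> n" "j \<in> tam_index n" "k \<in> fst (x n j)"
      using k by (auto simp: glue_def)
    define N where "N = max m n"
    have N: "1 \<le> N" "i \<in> tam_index N"
      using m tam_index_mono[of m N] by (auto simp: N_def)
    have "j \<in> fst (x N i)" "k \<in> fst (x N j)"
      using m n inverse_limit_window[OF x, of m N i] inverse_limit_window[OF x, of n N j]
      by (auto simp: N_def)
    with xc[OF N(1)] N have "k \<in> fst (x N i)" by (auto simp: mem_carrier_tam_poset_iff)
    with N show ?thesis by (auto simp: glue_def)
  qed
  ultimately show ?thesis
    by (auto simp: mem_carrier_Tam_bi_infinite_iff) (simp add: glue_def)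
qed

lemma glue_windows:
  assumes "\<rho> \<in> carrier Tam_bi_infinite"
  shows "glue (windows \<rho>) = \<rho>"
proof
  fix i
  \<comment> \<open>A point \<open>k\<close> of \<open>\<rho> i\<close> is recovered at a stage that sees both \<open>i\<close> and \<open>k\<close>.\<close>
  have "\<exists>n. 1 \<le> n \<and> i \<in> tam_index n \<and> k \<in> tam_index n" for k
  proof -
    obtain m n where mn: "1 \<le> m" "i \<in> tam_index m" "1 \<le> n" "k \<in> tam_index n"
      using tam_index_exhausts by blast
    then show ?thesis
      using tam_index_mono[of m "max m n"] tam_index_mono[of n "max m n"]
      by (intro exI[of _ "max m n"]) auto
  qed
  then have "fst (glue (windows \<rho>) i) = fst (\<rho> i)"
    by (fastforce simp: glue_def windows_def window_def)
  then show "glue (windows \<rho>) i = \<rho> i"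
    using assms by (simp add: prod_eq_iff mem_carrier_Tam_bi_infinite_iff) (simp add: glue_def)
qed

lemma windows_glue:
  assumes x: "x \<in> carrier (inverse_limit {1..} tam_poset tam_transition)"
  shows "windows (glue x) = x"
proof (rule extensionalityI[of _ "{1..}"])
  fix n :: nat assume "n \<in> {1..}"
  then have n: "1 \<le> n" by simp
  have xn: "x n \<in> carrier (tam_poset n)" using x n by (auto simp: inverse_limit_def)
  have "window n (glue x) = x n"
  proof (rule extensionalityI[of _ "tam_index n"])
    fix i assume i: "i \<in> tam_index n"
    have sub: "fst (x n i) \<subseteq> tam_index n"
      using xn n i by (auto simp: mem_carrier_tam_poset_iff)
    have "fst (x m i) \<inter> tam_index n \<subseteq> fst (x n i)" if "1 \<le> m" "i \<in> tam_index m" for m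
    proof (cases "m \<le> n")
      case True
      show ?thesis using inverse_limit_window[OF x that(1) True that(2)] by blast
    next
      case False
      then show ?thesis using inverse_limit_window[OF x n _ i, of m] by simp
    qed
    then have "fst (glue x i) \<inter> tam_index n \<subseteq> fst (x n i)"
      by (auto simp: glue_def)
    moreover have "fst (x n i) \<subseteq> fst (glue x i)"
      using n i by (auto simp: glue_def)
    ultimately have "fst (glue x i) \<inter> tam_index n = fst (x n i)"
      using sub by blast
    then show "window n (glue x) i = x n i"
      using xn n i by (simp add: window_def prod_eq_iff mem_carrier_tam_poset_iff)
  qed (use xn n in \<open>auto simp: window_def mem_carrier_tam_poset_iff\<close>)
  then show "windows (glue x) n = x n" using n by (simp add: windows_def)
qed (use x in \<open>auto simp: windows_def inverse_limit_def PiE_iff\<close>)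


section \<open>The isomorphism\<close>

lemma windows_mono:
  assumes "\<rho> \<sqsubseteq>\<^bsub>Tam_bi_infinite\<^esub> \<sigma>"
  shows "windows \<rho> \<sqsubseteq>\<^bsub>inverse_limit {1..} tam_poset tam_transition\<^esub> windows \<sigma>"
  using assms
  by (auto simp: Tam_bi_infinite_def inverse_limit_def tam_poset_def ornamentation_poset_def
      windows_def window_def)

lemma glue_mono:
  assumes "x \<sqsubseteq>\<^bsub>inverse_limit {1..} tam_poset tam_transition\<^esub> y"
  shows "glue x \<sqsubseteq>\<^bsub>Tam_bi_infinite\<^esub> glue y"
  using assms
  by (fastforce simp: Tam_bi_infinite_def inverse_limit_def tam_poset_def ornamentation_poset_def
      glue_def)

lemma poset_isomorphicI:
  assumes P: "partial_order P" and Q: "partial_order Q"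
    and f: "\<And>x. x \<in> carrier P \<Longrightarrow> f x \<in> carrier Q" "\<And>x. x \<in> carrier P \<Longrightarrow> g (f x) = x"
      "\<And>x y. x \<in> carrier P \<Longrightarrow> y \<in> carrier P \<Longrightarrow> x \<sqsubseteq>\<^bsub>P\<^esub> y \<Longrightarrow> f x \<sqsubseteq>\<^bsub>Q\<^esub> f y"
    and g: "\<And>x. x \<in> carrier Q \<Longrightarrow> g x \<in> carrier P" "\<And>x. x \<in> carrier Q \<Longrightarrow> f (g x) = x"
      "\<And>x y. x \<in> carrier Q \<Longrightarrow> y \<in> carrier Q \<Longrightarrow> x \<sqsubseteq>\<^bsub>Q\<^esub> y \<Longrightarrow> g x \<sqsubseteq>\<^bsub>P\<^esub> g y"
  shows "P \<simeq>\<^sub>p Q"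
proof -
  have bij: "bij_betw f (carrier P) (carrier Q)"
    by (rule bij_betw_byWitness[of _ g]) (use f g in auto)
  have inv: "inv_into (carrier P) f y = g y" if "y \<in> carrier Q" for y
    using bij that f g by (intro inv_into_f_eq) (auto simp: bij_betw_def)
  have weak: "weak_partial_order P" "weak_partial_order Q"
    using P Q by (simp_all add: partial_order_def)
  have "poset_hom P Q f" "poset_hom Q P (inv_into (carrier P) f)"
    using weak f g inv by (auto simp: poset_hom_def isotone_def)
  with bij P Q show ?thesis unfolding poset_isomorphic_def poset_iso_def by blast
qed

theorem corollary7p10:
  shows "Tam_bi_infinite \<simeq>\<^sub>p inverse_limit {1::nat..} tam_poset tam_transition"
proof (rule poset_isomorphicI[where f = windows and g = glue])
  show "partial_order Tam_bi_infinite"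
    by (simp add: Tam_bi_infinite_def partial_order_ornamentation_poset)
  show "partial_order (inverse_limit {1::nat..} tam_poset tam_transition)"
    by (rule poset_inverse_system.partial_order_inverse_limit[OF tam_inverse_system])
qed (erule windows_in_carrier glue_windows windows_mono glue_in_carrier windows_glue glue_mono)+

end
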